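(* Consider the (non-dimensional) one-dimensional design problems described in the context, with $k_H>k_L>0$ and $0\le\gamma\le1$, and for a single-interface layout with permeabilities $k_1$ (left) and $k_2$ (right) and interface at $\xi$ put $$\Upsilon_{\mathrm{1D}}(\xi):=\frac{\xi}{k_1}+\frac{1-\xi}{k_2}.$$ (1) Pressure-driven problem. Under the Barus model with $\beta_{\mathrm B}>0$, $$v(x)=\Phi(\xi)=\frac{1}{\beta_{\mathrm B}}\left(1-\exp[-\beta_{\mathrm B}]\right)\Upsilon_{\mathrm{1D}}(\xi)^{-1}.$$ Under the Darcy-Forchheimer model with $\beta_{\mathrm F}>0$, $$v(x)=\Phi(\xi)=\frac{\sqrt{1+4\beta_{\mathrm F}\Upsilon_{\mathrm{1D}}(\xi)^{-1}}-1}{2\beta_{\mathrm F}}.$$ (2) Velocity-driven problem. Under the linearized Barus model with $\beta_{\mathrm B}>0$, $$v(x)=1,\qquad \Phi(\xi)=\frac{1}{\beta_{\mathrm B}}\left(\exp[\beta_{\mathrm B}\Upsilon_{\mathrm{1D}}(\xi)]-1\right).$$ Under the Darcy-Forchheimer model with $\beta_{\mathrm F}>0$, $$v(x)=1,\qquad \Phi(\xi)=(1+\beta_{\mathrm F})\Upsilon_{\mathrm{1D}}(\xi).$$ (3) Optimal layout. For the pressure-driven problem (maximizing $\Phi$) under the Darcy, Barus and Darcy-Forchheimer models, and for the velocity-driven problem (minimizing $\Phi$) under the Darcy, linearized Barus and Darcy-Forchheimer models, the design problem over admissible single-interface layouts is equivalent to minimizing $\Upsilon_{\mathrm{1D}}$,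 and an optimal layout is obtained by placing the high-permeability material, occupying exactly the fraction $\gamma$ of the domain, either at the inflow ($k_1=k_H$, $k_2=k_L$, $\xi=\gamma$) or at the outflow ($k_1=k_L$, $k_2=k_H$, $\xi=1-\gamma$); both placements are optimal, and the optimal layouts are the same for all these models.
   Context: The domain is the interval $(0,1)$ and all quantities are non-dimensional. Two porous materials with permeabilities $k_H$ (high) and $k_L$ (low) fill the interval. A single-interface layout is a permeability field $$k(x)=k_1\ \text{ for }0<x<\xi,\qquad k(x)=k_2\ \text{ for }\xi<x<1,$$ where $\xi\in[0,1]$ and either $(k_1,k_2)=(k_H,k_L)$ or $(k_1,k_2)=(k_L,k_H)$. It is admissible if the length occupied by the high-permeability material is at most $\gamma$, i.e. $\xi\le\gamma$ when $(k_1,k_2)=(k_H,k_L)$ and $1-\xi\le\gamma$ when $(k_1,k_2)=(k_L,k_H)$. For a given layout, the velocity $v$ and pressure $p$ solve $$\alpha\,v+\frac{dp}{dx}=0,\qquad \frac{dv}{dx}=0\quad\text{in }(0,1)$$ (away from the interface), with $v$ and $p$ continuous at $x=\xi$. The drag coefficient $\alpha$ is: - Darcy model: $\alpha=1/k(x)$; - Barus model: $\alpha=\exp[\beta_{\mathrm B}p]/k(x)$; - linearized Barus model: $\alpha=(1+\beta_{\mathrm B}p)/k(x)$; - Darcy-Forchheimer model: $\alpha=(1+\beta_{\mathrm F}|v|)/k(x)$. The pressure-driven problem has boundary conditions $p(0)=1$, $p(1)=0$. The velocity-driven problem has boundary conditions $v(0)=1$, $p(1)=0$. The total rate of dissipation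 is $\Phi=\int_0^1\alpha\,v^2\,dx$. The design problem is to maximize $\Phi$ over admissible layouts for the pressure-driven problem, and to minimize $\Phi$ over admissible layouts for the velocity-driven problem. *)

theory Defs
  imports "HOL-Analysis.Analysis"
begin

datatype layout = Layout (perm_left: real) (perm_right: real) (interface_pos: real)

definition single_interface_layout :: "real \<Rightarrow> real \<Rightarrow> layout \<Rightarrow> bool" where
  "single_interface_layout kH kL L \<longleftrightarrow>
     0 \<le> interface_pos L \<and> interface_pos L \<le> 1 \<and>
     ((perm_left L = kH \<and> perm_right L = kL) \<or> (perm_left L = kL \<and> perm_right L = kH))"

definition admissible :: "real \<Rightarrow> real \<Rightarrow> real \<Rightarrow> layout \<Rightarrow> bool" where
  "admissible kH kL \<gamma> L \<longleftrightarrow>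
     single_interface_layout kH kL L \<and>
     (perm_left L = kH \<and> perm_right L = kL \<longrightarrow> interface_pos L \<le> \<gamma>) \<and>
     (perm_left L = kL \<and> perm_right L = kH \<longrightarrow> 1 - interface_pos L \<le> \<gamma>)"

(* The value chosen at the interface itself plays no role: the equations are imposed
   away from it, and it does not affect the dissipation integral. *)
definition permeability :: "layout \<Rightarrow> real \<Rightarrow> real" where
  "permeability L x = (if x < interface_pos L then perm_left L else perm_right L)"

definition Upsilon :: "layout \<Rightarrow> real" where
  "Upsilon L = interface_pos L / perm_left L + (1 - interface_pos L) / perm_right L"

datatype model = Darcy | Barus real | Linearized_Barus real | Darcy_Forchheimer real

(* Arguments of drag: model, local permeability, pressure, velocity. *)
fun drag :: "model \<Rightarrow> real \<Rightarrow> real \<Rightarrow> real \<Rightarrow> real" where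
  "drag Darcy k p v = 1 / k"
| "drag (Barus \<beta>) k p v = exp (\<beta> * p) / k"
| "drag (Linearized_Barus \<beta>) k p v = (1 + \<beta> * p) / k"
| "drag (Darcy_Forchheimer \<beta>) k p v = (1 + \<beta> * \<bar>v\<bar>) / k"

datatype driving = Pressure_Driven | Velocity_Driven

fun boundary_conditions :: "driving \<Rightarrow> (real \<Rightarrow> real) \<Rightarrow> (real \<Rightarrow> real) \<Rightarrow> bool" where
  "boundary_conditions Pressure_Driven v p \<longleftrightarrow> p 0 = 1 \<and> p 1 = 0"
| "boundary_conditions Velocity_Driven v p \<longleftrightarrow> v 0 = 1 \<and> p 1 = 0"

(* Continuity on the closed interval covers both the matching conditions at the interface
   and the attainment of the boundary values. *)
definition solves ::
    "driving \<Rightarrow> model \<Rightarrow> layout \<Rightarrow> (real \<Rightarrow> real) \<Rightarrow> (real \<Rightarrow> real) \<Rightarrow> bool" where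
  "solves d M L v p \<longleftrightarrow>
     continuous_on {0..1} v \<and> continuous_on {0..1} p \<and>
     (\<forall>x\<in>{0<..<1} - {interface_pos L}.
        (\<exists>p'. (p has_real_derivative p') (at x) \<and>
              drag M (permeability L x) (p x) (v x) * v x + p' = 0) \<and>
        (v has_real_derivative 0) (at x)) \<and>
     boundary_conditions d v p"

definition well_posed :: "driving \<Rightarrow> model \<Rightarrow> layout \<Rightarrow> bool" where
  "well_posed d M L \<longleftrightarrow>
     (\<exists>v p. solves d M L v p) \<and>
     (\<forall>v p v' p'. solves d M L v p \<longrightarrow> solves d M L v' p' \<longrightarrow>
        (\<forall>x\<in>{0..1}. v x = v' x \<and> p x = p' x))"

definition dissipation_integral ::
    "model \<Rightarrow> layout \<Rightarrow> (real \<Rightarrow> real) \<Rightarrow> (real \<Rightarrow> real) \<Rightarrow> real" where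
  "dissipation_integral M L v p =
     integral {0..1} (\<lambda>x. drag M (permeability L x) (p x) (v x) * (v x)\<^sup>2)"

(* Meaningful whenever the problem is well posed: two solutions may then differ only
   outside the unit interval, so they have the same dissipation. *)
definition Phi :: "driving \<Rightarrow> model \<Rightarrow> layout \<Rightarrow> real" where
  "Phi d M L = (THE \<phi>. \<exists>v p. solves d M L v p \<and> \<phi> = dissipation_integral M L v p)"

fun at_least_as_good :: "driving \<Rightarrow> model \<Rightarrow> layout \<Rightarrow> layout \<Rightarrow> bool" where
  "at_least_as_good Pressure_Driven M L L' \<longleftrightarrow> Phi Pressure_Driven M L \<ge> Phi Pressure_Driven M L'"
| "at_least_as_good Velocity_Driven M L L' \<longleftrightarrow> Phi Velocity_Driven M L \<le> Phi Velocity_Driven M L'"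

definition optimal_layouts :: "driving \<Rightarrow> model \<Rightarrow> real \<Rightarrow> real \<Rightarrow> real \<Rightarrow> layout set" where
  "optimal_layouts d M kH kL \<gamma> =
     {L. admissible kH kL \<gamma> L \<and> (\<forall>L'. admissible kH kL \<gamma> L' \<longrightarrow> at_least_as_good d M L L')}"

definition Upsilon_minimizers :: "real \<Rightarrow> real \<Rightarrow> real \<Rightarrow> layout set" where
  "Upsilon_minimizers kH kL \<gamma> =
     {L. admissible kH kL \<gamma> L \<and> (\<forall>L'. admissible kH kL \<gamma> L' \<longrightarrow> Upsilon L \<le> Upsilon L')}"

definition design_problems :: "real \<Rightarrow> real \<Rightarrow> (driving \<times> model) set" where
  "design_problems \<beta>B \<beta>F =
     {Pressure_Driven} \<times> {Darcy, Barus \<beta>B, Darcy_Forchheimer \<beta>F} \<union>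
     {Velocity_Driven} \<times> {Darcy, Linearized_Barus \<beta>B, Darcy_Forchheimer \<beta>F}"

end

theory Submission
  imports Defs
begin

text \<open>
  Since the velocity is continuous and has vanishing derivative off the interface, it is a
  constant \<open>c\<close>.  The momentum balance then prescribes the slope of the pressure, and it separates:
  apart from the linearized Barus model the drag has the form \<open>g v / (k * G' p)\<close>, so the momentum
  balance says that \<open>G p\<close> decreases at the rate \<open>c * g c / k\<close>.  Hence the only thing a solution
  sees of the layout is its resistance, the integral of \<open>1 / k\<close> from a point to the outlet
  (\<open>transformed_pressure\<close>), whose value at the inlet is \<open>\<Upsilon>\<close>.  The boundary conditions turn this
  into an algebraic equation for \<open>c\<close> (pressure-driven) or into a formula for \<open>p 0\<close>
  (velocity-driven).  For the linearized Barus model the factor \<open>1 + \<beta> p\<close> might vanish, so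
  division is replaced by an integrating factor.

  The dissipation needs no further integration: it equals \<open>c * (p 0 - p 1)\<close>, the power spent by
  the boundary pressures (\<open>dissipation_eq_boundary_power\<close>).  So it is the velocity itself in
  the pressure-driven problem and the inlet pressure in the velocity-driven one.  In all six design
  problems the dissipation is therefore a strictly monotone function of \<open>\<Upsilon>\<close>, decreasing
  where it is maximized and increasing where it is minimized, so that every problem amounts to
  minimizing \<open>\<Upsilon>\<close>.  Finally \<open>\<Upsilon>\<close> depends on a layout only through the length of its highly permeable
  part, and strictly decreases with it, which leaves the two layouts that use up the whole
  allowance \<open>\<gamma>\<close>.
\<close>

section \<open>Solutions and their dissipation\<close>

lemma constant_off_interface:
  fixes F :: "real \<Rightarrow> real"
  assumes "continuous_on {0..1} F"
    and "\<And>x. x \<in> {0<..<1} - {a} \<Longrightarrow> (F has_real_derivative 0) (at x)"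
    and "x \<in> {0..1}"
  shows "F x = F 1"
proof -
  have "F y = F 0" if "y \<in> {0..1}" for y
  proof (rule has_derivative_zero_unique_strong_interval[of "{0, 1, a}" 0 1 F])
    fix z assume "z \<in> {0..1} - {0, 1, a}"
    then have "(F has_real_derivative 0) (at z within {0..1})"
      by (intro DERIV_subset[OF assms(2)]) auto
    then show "(F has_derivative (\<lambda>h. 0)) (at z within {0..1})"
      by (simp add: has_field_derivative_def mult_zero_left[abs_def])
  qed (use assms that in auto)
  from this[of x] this[of 1] show ?thesis using assms(3) by simp
qed

lemma solves_pressure_derivative:
  assumes "solves d M L v p" "x \<in> {0<..<1} - {interface_pos L}"
  shows "(p has_real_derivative - (drag M (permeability L x) (p x) (v x) * v x)) (at x)"
proof -
  obtain p' where "(p has_real_derivative p') (at x)"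
    and "drag M (permeability L x) (p x) (v x) * v x + p' = 0"
    using assms unfolding solves_def by blast
  moreover from this(2) have "p' = - (drag M (permeability L x) (p x) (v x) * v x)" by linarith
  ultimately show ?thesis by simp
qed

lemma solves_velocity_constant:
  assumes "solves d M L v p" "x \<in> {0..1}"
  shows "v x = v 1"
  using assms unfolding solves_def by (intro constant_off_interface[of v "interface_pos L"]) auto

text \<open>Local energy balance: with constant velocity the dissipation density is the derivative of
  \<open>- v * p\<close>, so the fundamental theorem of calculus leaves only boundary terms.\<close>

lemma dissipation_eq_boundary_power:
  assumes sol: "solves d M L v p"
  shows "dissipation_integral M L v p = v 1 * (p 0 - p 1)"
proof -
  let ?f = "\<lambda>x. - (v 1 * p x)"
  let ?f' = "\<lambda>x. drag M (permeability L x) (p x) (v x) * (v x)\<^sup>2"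
  have "(?f' has_integral ?f 1 - ?f 0) {0..1}"
  proof (rule fundamental_theorem_of_calculus_interior_strong[of "{interface_pos L}"])
    fix x assume x: "x \<in> {0<..<1} - {interface_pos L}"
    then have "v 1 = v x"
      using solves_velocity_constant[OF sol, of x] by simp
    then have "(?f has_real_derivative ?f' x) (at x)"
      using solves_pressure_derivative[OF sol x]
      by (auto intro!: derivative_eq_intros simp: power2_eq_square)
    then show "(?f has_vector_derivative ?f' x) (at x)"
      by (simp add: has_real_derivative_iff_has_vector_derivative)
  next
    show "continuous_on {0..1} ?f"
      using sol unfolding solves_def by (intro continuous_intros) auto
  qed auto
  then show ?thesis
    unfolding dissipation_integral_def by (simp add: integral_unique algebra_simps)
qed

definition unique_flow :: "driving \<Rightarrow> model \<Rightarrow> layout \<Rightarrow> real \<Rightarrow> (real \<Rightarrow> real) \<Rightarrow> bool" where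
  "unique_flow d M L c P \<longleftrightarrow>
     solves d M L (\<lambda>_. c) P \<and>
     (\<forall>v p. solves d M L v p \<longrightarrow> (\<forall>x\<in>{0..1}. v x = c \<and> p x = P x))"

lemma unique_flow_well_posed: "unique_flow d M L c P \<Longrightarrow> well_posed d M L"
  unfolding unique_flow_def well_posed_def by metis

text \<open>Only the velocity and the inlet and outlet pressures enter the dissipation, so uniqueness on the
  unit interval already determines it, although solutions are functions on the whole line.\<close>

lemma unique_flow_dissipation:
  assumes "unique_flow d M L c P" "solves d M L v p"
  shows "dissipation_integral M L v p = c * (P 0 - P 1)"
  using assms dissipation_eq_boundary_power[OF assms(2)] unfolding unique_flow_def by simp

lemma unique_flow_Phi:
  assumes "unique_flow d M L c P"
  shows "Phi d M L = c * (P 0 - P 1)"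
  unfolding Phi_def
proof (rule the_equality)
  show "\<exists>v p. solves d M L v p \<and> c * (P 0 - P 1) = dissipation_integral M L v p"
    using assms unique_flow_dissipation[OF assms] unfolding unique_flow_def by metis
qed (use unique_flow_dissipation[OF assms] in auto)

lemma pressure_driven_flow:
  assumes "unique_flow Pressure_Driven M L c P"
  shows "Phi Pressure_Driven M L = c"
    and "solves Pressure_Driven M L v p \<Longrightarrow>
      (\<forall>x\<in>{0..1}. v x = c) \<and> dissipation_integral M L v p = c"
proof -
  have "P 0 = 1" "P 1 = 0" using assms unfolding unique_flow_def solves_def by auto
  then show "Phi Pressure_Driven M L = c"
    and "solves Pressure_Driven M L v p \<Longrightarrow>
      (\<forall>x\<in>{0..1}. v x = c) \<and> dissipation_integral M L v p = c"
    using unique_flow_Phi[OF assms] unique_flow_dissipation[OF assms] assms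
    unfolding unique_flow_def by auto
qed

lemma velocity_driven_flow:
  assumes "unique_flow Velocity_Driven M L 1 P"
  shows "Phi Velocity_Driven M L = P 0"
    and "solves Velocity_Driven M L v p \<Longrightarrow>
      (\<forall>x\<in>{0..1}. v x = 1) \<and> dissipation_integral M L v p = P 0"
proof -
  have "P 1 = 0" using assms unfolding unique_flow_def solves_def by auto
  then show "Phi Velocity_Driven M L = P 0"
    and "solves Velocity_Driven M L v p \<Longrightarrow>
      (\<forall>x\<in>{0..1}. v x = 1) \<and> dissipation_integral M L v p = P 0"
    using unique_flow_Phi[OF assms] unique_flow_dissipation[OF assms] assms
    unfolding unique_flow_def by auto
qed

section \<open>Resistance to the outlet\<close>

text \<open>The integral of \<open>1 / k\<close> over the interval from \<open>x\<close> to the outlet.  In this form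
  continuity and monotonicity can be read off, also at the interface.\<close>

definition resistance :: "layout \<Rightarrow> real \<Rightarrow> real" where
  "resistance L x =
     max 0 (interface_pos L - x) / perm_left L + min (1 - interface_pos L) (1 - x) / perm_right L"

locale two_layer_medium =
  fixes L :: layout
  assumes perm_left_pos: "0 < perm_left L" and perm_right_pos: "0 < perm_right L"
    and interface_nonneg: "0 \<le> interface_pos L" and interface_le_1: "interface_pos L \<le> 1"
begin

lemma permeability_pos: "0 < permeability L x"
  using perm_left_pos perm_right_pos by (simp add: permeability_def)

lemma Upsilon_pos: "0 < Upsilon L"
proof (cases "interface_pos L = 0")
  case False
  then have "0 < interface_pos L / perm_left L"
    using perm_left_pos interface_nonneg by simp
  moreover have "0 \<le> (1 - interface_pos L) / perm_right L"
    using perm_right_pos interface_le_1 by simp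
  ultimately show ?thesis unfolding Upsilon_def by linarith
qed (use perm_right_pos in \<open>simp add: Upsilon_def\<close>)

lemma resistance_inlet: "resistance L 0 = Upsilon L"
  using interface_nonneg by (simp add: resistance_def Upsilon_def)

lemma resistance_outlet [simp]: "resistance L 1 = 0"
  using interface_le_1 by (simp add: resistance_def)

lemma resistance_continuous: "continuous_on A (resistance L)"
  unfolding resistance_def using perm_left_pos perm_right_pos by (intro continuous_intros) auto

lemma resistance_derivative:
  assumes "x \<noteq> interface_pos L"
  shows "(resistance L has_real_derivative - (1 / permeability L x)) (at x)"
proof (cases "x < interface_pos L")
  case True
  have "((\<lambda>x. (interface_pos L - x) / perm_left L + (1 - interface_pos L) / perm_right L)
      has_real_derivative - (1 / permeability L x)) (at x)"
    using True perm_left_pos by (auto intro!: derivative_eq_intros simp: permeability_def)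
  then show ?thesis
    by (rule has_field_derivative_transform_within_open[where S = "{..<interface_pos L}"])
      (use True in \<open>auto simp: resistance_def\<close>)
next
  case False
  have "((\<lambda>x. (1 - x) / perm_right L) has_real_derivative - (1 / permeability L x)) (at x)"
    using False perm_right_pos by (auto intro!: derivative_eq_intros simp: permeability_def)
  then show ?thesis
    by (rule has_field_derivative_transform_within_open[where S = "{interface_pos L<..}"])
      (use False assms in \<open>auto simp: resistance_def\<close>)
qed

lemma resistance_bounds:
  assumes "x \<in> {0..1}"
  shows "0 \<le> resistance L x" "resistance L x \<le> Upsilon L"
proof -
  show "0 \<le> resistance L x"
    using assms perm_left_pos perm_right_pos interface_le_1 by (simp add: resistance_def)
  have "resistance L x \<le> resistance L 0"
    unfolding resistance_def using assms perm_left_pos perm_right_pos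
    by (intro add_mono divide_right_mono) auto
  then show "resistance L x \<le> Upsilon L" by (simp add: resistance_inlet)
qed

section \<open>The flow in each model\<close>

text \<open>Separation of variables: \<open>G\<close> is a primitive of the reciprocal of the pressure factor of
  the drag, so \<open>G p\<close> obeys Darcy's law with the constant flux \<open>v 1 * g (v 1)\<close>.\<close>

lemma transformed_pressure:
  assumes sol: "solves d M L v p"
    and drag: "\<And>k p v. drag M k p v = g v / (k * G' p)"
    and G: "\<And>y. (G has_real_derivative G' y) (at y)"
    and nz: "\<And>y. G' y \<noteq> 0"
    and x: "x \<in> {0..1}"
  shows "G (p x) = G (p 1) + v 1 * g (v 1) * resistance L x"
proof -
  let ?F = "\<lambda>x. G (p x) - v 1 * g (v 1) * resistance L x"
  have "?F x = ?F 1"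
  proof (rule constant_off_interface[OF _ _ x])
    have "continuous_on UNIV G"
      using G by (meson DERIV_isCont continuous_at_imp_continuous_on)
    moreover have "continuous_on {0..1} p"
      using sol unfolding solves_def by blast
    ultimately show "continuous_on {0..1} ?F"
      using resistance_continuous
      by (auto intro!: continuous_intros intro: continuous_on_compose2)
  next
    fix z assume z: "z \<in> {0<..<1} - {interface_pos L}"
    then have vz: "v z = v 1"
      by (intro solves_velocity_constant[OF sol]) auto
    have "(?F has_real_derivative G' (p z) * - (drag M (permeability L z) (p z) (v z) * v z)
        - v 1 * g (v 1) * - (1 / permeability L z)) (at z)"
      using z by (intro DERIV_diff DERIV_chain2[OF G] DERIV_cmult
          solves_pressure_derivative[OF sol] resistance_derivative) auto
    then show "(?F has_real_derivative 0) (at z)"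
      by (simp add: drag vz nz)
  qed
  then show ?thesis by simp
qed

lemma affine_flow_solves:
  assumes drag: "\<And>k p v. drag M k p v = g v / k"
    and bc: "boundary_conditions d (\<lambda>_. c) (\<lambda>x. c * g c * resistance L x)"
  shows "solves d M L (\<lambda>_. c) (\<lambda>x. c * g c * resistance L x)"
  unfolding solves_def
proof (intro conjI ballI bc)
  show "continuous_on {0..1} (\<lambda>x. c * g c * resistance L x)"
    using resistance_continuous by (intro continuous_intros)
next
  fix x assume "x \<in> {0<..<1} - {interface_pos L}"
  then have "((\<lambda>x. c * g c * resistance L x) has_real_derivative
      c * g c * - (1 / permeability L x)) (at x)"
    by (intro DERIV_cmult resistance_derivative) auto
  then show "\<exists>p'. ((\<lambda>x. c * g c * resistance L x) has_real_derivative p') (at x) \<and>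
      drag M (permeability L x) (c * g c * resistance L x) c * c + p' = 0"
    by (intro exI conjI) (auto simp: drag)
qed auto

text \<open>Darcy and Darcy--Forchheimer drag do not involve the pressure, so no transformation of the
  pressure is needed: \<open>G\<close> is the identity.\<close>

lemma affine_pressure:
  assumes "solves d M L v p" and "\<And>k p v. drag M k p v = g v / k" and "x \<in> {0..1}"
  shows "p x = p 1 + v 1 * g (v 1) * resistance L x"
  using transformed_pressure[OF assms(1), where G = "\<lambda>y. y" and G' = "\<lambda>_. 1" and g = g and x = x]
    assms(2,3) by simp

lemma unique_flow_velocity_driven_affine:
  assumes drag: "\<And>k p v. drag M k p v = g v / k"
  shows "unique_flow Velocity_Driven M L 1 (\<lambda>x. g 1 * resistance L x)"
  unfolding unique_flow_def
proof (intro conjI allI impI ballI)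
  show "solves Velocity_Driven M L (\<lambda>_. 1) (\<lambda>x. g 1 * resistance L x)"
    using affine_flow_solves[where c = 1 and g = g and M = M and d = Velocity_Driven] drag by simp
next
  fix v p x assume sol: "solves Velocity_Driven M L v p" and x: "x \<in> {0..1::real}"
  have bc: "v 0 = 1" "p 1 = 0" using sol unfolding solves_def by auto
  then have v1: "v 1 = 1" using solves_velocity_constant[OF sol, of 0] by simp
  then show "v x = 1" using solves_velocity_constant[OF sol x] by simp
  show "p x = g 1 * resistance L x"
    using affine_pressure[where g = g, OF sol drag x] bc v1 by simp
qed

lemma unique_flow_pressure_driven_affine:
  assumes drag: "\<And>k p v. drag M k p v = g v / k"
    and c: "\<And>w. w * g w = 1 / Upsilon L \<longleftrightarrow> w = c"
  shows "unique_flow Pressure_Driven M L c (\<lambda>x. resistance L x / Upsilon L)"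
  unfolding unique_flow_def
proof (intro conjI allI impI ballI)
  have c': "c * g c = 1 / Upsilon L" using c by blast
  show "solves Pressure_Driven M L (\<lambda>_. c) (\<lambda>x. resistance L x / Upsilon L)"
    using affine_flow_solves[where c = c and g = g and M = M and d = Pressure_Driven] drag Upsilon_pos
    by (simp add: c' resistance_inlet)
next
  fix v p x assume sol: "solves Pressure_Driven M L v p" and x: "x \<in> {0..1::real}"
  have bc: "p 0 = 1" "p 1 = 0" using sol unfolding solves_def by auto
  have "1 = v 1 * g (v 1) * Upsilon L"
    using affine_pressure[where g = g, OF sol drag, of 0] bc by (simp add: resistance_inlet)
  then have *: "v 1 * g (v 1) = 1 / Upsilon L"
    using Upsilon_pos by (simp add: field_simps)
  then show "v x = c" using c solves_velocity_constant[OF sol x] by simp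
  show "p x = resistance L x / Upsilon L"
    using affine_pressure[where g = g, OF sol drag x] bc * by simp
qed

lemma unique_flow_pressure_driven_Darcy:
  "unique_flow Pressure_Driven Darcy L (1 / Upsilon L) (\<lambda>x. resistance L x / Upsilon L)"
  by (rule unique_flow_pressure_driven_affine[where g = "\<lambda>_. 1"]) auto

lemma unique_flow_velocity_driven_Darcy:
  "unique_flow Velocity_Driven Darcy L 1 (resistance L)"
  using unique_flow_velocity_driven_affine[where g = "\<lambda>_. 1" and M = Darcy] by simp

lemma unique_flow_velocity_driven_Forchheimer:
  "unique_flow Velocity_Driven (Darcy_Forchheimer \<beta>) L 1 (\<lambda>x. (1 + \<beta>) * resistance L x)"
  using unique_flow_velocity_driven_affine[where g = "\<lambda>v. 1 + \<beta> * \<bar>v\<bar>" and M = "Darcy_Forchheimer \<beta>"]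
  by simp

end

text \<open>A solution of the Forchheimer equation with positive right-hand side is positive, hence it is the
  positive root of a quadratic.\<close>

lemma Forchheimer_equation_iff:
  fixes \<beta> s w :: real
  assumes "0 < \<beta>" "0 < s"
  shows "w * (1 + \<beta> * \<bar>w\<bar>) = s \<longleftrightarrow> w = (sqrt (1 + 4 * \<beta> * s) - 1) / (2 * \<beta>)"
proof
  assume eq: "w * (1 + \<beta> * \<bar>w\<bar>) = s"
  have "0 < 1 + \<beta> * \<bar>w\<bar>" using assms(1) by (simp add: add_pos_nonneg)
  then have w: "0 < w" using eq assms(2) by (metis zero_less_mult_pos2)
  have "(2 * \<beta> * w + 1)\<^sup>2 = 1 + 4 * \<beta> * s"
    using w by (simp flip: eq add: power2_eq_square algebra_simps)
  then have "sqrt (1 + 4 * \<beta> * s) = 2 * \<beta> * w + 1"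
    using w assms(1) by (intro real_sqrt_unique) auto
  then show "w = (sqrt (1 + 4 * \<beta> * s) - 1) / (2 * \<beta>)" using assms(1) by simp
next
  let ?r = "sqrt (1 + 4 * \<beta> * s)"
  assume w: "w = (?r - 1) / (2 * \<beta>)"
  have "1 \<le> ?r" using assms by simp
  then have "0 \<le> w" using w assms(1) by simp
  have r: "?r = 2 * \<beta> * w + 1" using w assms(1) by simp
  have "?r\<^sup>2 = 1 + 4 * \<beta> * s" using assms by (intro real_sqrt_pow2) simp
  then have "4 * \<beta> * (w * (1 + \<beta> * w)) = 4 * \<beta> * s"
    unfolding r by (simp add: power2_eq_square algebra_simps)
  then show "w * (1 + \<beta> * \<bar>w\<bar>) = s" using assms(1) \<open>0 \<le> w\<close> by simp
qed

context two_layer_medium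
begin

lemma unique_flow_pressure_driven_Forchheimer:
  assumes "0 < \<beta>"
  shows "unique_flow Pressure_Driven (Darcy_Forchheimer \<beta>) L
    ((sqrt (1 + 4 * \<beta> * inverse (Upsilon L)) - 1) / (2 * \<beta>)) (\<lambda>x. resistance L x / Upsilon L)"
  using Forchheimer_equation_iff[OF assms, of "1 / Upsilon L"] Upsilon_pos
  by (intro unique_flow_pressure_driven_affine[where g = "\<lambda>v. 1 + \<beta> * \<bar>v\<bar>"])
    (auto simp: inverse_eq_divide)

text \<open>With \<open>G y = (1 - exp (- \<beta> y)) / \<beta>\<close> the separated equation reads
  \<open>exp (- \<beta> p) = 1 - \<beta> c R\<close>, which can be solved for \<open>p\<close> because
  \<open>\<beta> c R \<le> 1 - exp (- \<beta>) < 1\<close> throughout the medium.\<close>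

lemma unique_flow_pressure_driven_Barus:
  assumes \<beta>: "0 < \<beta>"
  defines "c \<equiv> 1 / \<beta> * (1 - exp (- \<beta>)) * inverse (Upsilon L)"
  shows "unique_flow Pressure_Driven (Barus \<beta>) L c (\<lambda>x. - ln (1 - \<beta> * c * resistance L x) / \<beta>)"
  unfolding unique_flow_def
proof (intro conjI allI impI ballI)
  let ?P = "\<lambda>x. - ln (1 - \<beta> * c * resistance L x) / \<beta>"
  have cU: "\<beta> * c * Upsilon L = 1 - exp (- \<beta>)"
    using \<beta> Upsilon_pos by (simp add: c_def)
  have "0 \<le> \<beta> * c"
    using \<beta> Upsilon_pos by (simp add: c_def)
  then have "\<beta> * c * resistance L x \<le> \<beta> * c * Upsilon L" if "x \<in> {0..1}" for x
    using resistance_bounds[OF that] by (intro mult_left_mono) auto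
  then have pos: "0 < 1 - \<beta> * c * resistance L x" if "x \<in> {0..1}" for x
    using that cU exp_gt_zero[of "- \<beta>"] by (smt (verit))
  show "solves Pressure_Driven (Barus \<beta>) L (\<lambda>_. c) ?P"
    unfolding solves_def
  proof (intro conjI ballI)
    show "continuous_on {0..1} ?P"
      using pos \<beta> by (intro continuous_intros resistance_continuous) force+
    show "boundary_conditions Pressure_Driven (\<lambda>_. c) ?P"
      using \<beta> by (simp add: resistance_inlet cU)
  next
    fix x assume x: "x \<in> {0<..<1} - {interface_pos L}"
    then have pos': "0 < 1 - \<beta> * c * resistance L x" by (intro pos) auto
    have d: "(resistance L has_real_derivative - (1 / permeability L x)) (at x)"
      using x by (intro resistance_derivative) auto
    have "(?P has_real_derivative - (c / (permeability L x * (1 - \<beta> * c * resistance L x)))) (at x)"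
      using pos' \<beta> permeability_pos[of x]
      by (auto intro!: derivative_eq_intros d simp: field_simps)
    moreover have "exp (\<beta> * ?P x) = 1 / (1 - \<beta> * c * resistance L x)"
      using pos' \<beta> by (simp add: exp_minus inverse_eq_divide)
    ultimately show "\<exists>p'. (?P has_real_derivative p') (at x) \<and>
        drag (Barus \<beta>) (permeability L x) (?P x) c * c + p' = 0"
      by (intro exI conjI) auto
  qed auto
next
  let ?G = "\<lambda>y. (1 - exp (- (\<beta> * y))) / \<beta>"
  fix v p x assume sol: "solves Pressure_Driven (Barus \<beta>) L v p" and x: "x \<in> {0..1::real}"
  have bc: "p 0 = 1" "p 1 = 0" using sol unfolding solves_def by auto
  have G: "?G (p y) = ?G (p 1) + v 1 * 1 * resistance L y" if "y \<in> {0..1}" for y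
  proof (rule transformed_pressure[OF sol, where G' = "\<lambda>y. exp (- (\<beta> * y))" and g = "\<lambda>_. 1"])
    show "(?G has_real_derivative exp (- (\<beta> * y))) (at y)" for y
      using \<beta> by (auto intro!: derivative_eq_intros)
  qed (use that in \<open>auto simp: exp_minus field_simps\<close>)
  have v1: "v 1 = c"
    using G[of 0] bc Upsilon_pos \<beta> by (simp add: resistance_inlet c_def field_simps)
  then show "v x = c" using solves_velocity_constant[OF sol x] by simp
  have "exp (- (\<beta> * p x)) = 1 - \<beta> * c * resistance L x"
    using G[OF x] bc v1 \<beta> by (simp add: field_simps)
  then have "- (\<beta> * p x) = ln (1 - \<beta> * c * resistance L x)"
    by (metis ln_exp)
  then show "p x = - ln (1 - \<beta> * c * resistance L x) / \<beta>"
    using \<beta> by (simp add: field_simps)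
qed

text \<open>The momentum balance is linear in \<open>1 + \<beta> p\<close>; with \<open>R\<close> the resistance, the
  integrating factor \<open>exp (- \<beta> R)\<close> makes their product constant, whatever the sign of
  \<open>1 + \<beta> p\<close>.\<close>

lemma unique_flow_velocity_driven_linearized_Barus:
  assumes \<beta>: "0 < \<beta>"
  shows "unique_flow Velocity_Driven (Linearized_Barus \<beta>) L 1
    (\<lambda>x. (exp (\<beta> * resistance L x) - 1) / \<beta>)"
  unfolding unique_flow_def
proof (intro conjI allI impI ballI)
  let ?P = "\<lambda>x. (exp (\<beta> * resistance L x) - 1) / \<beta>"
  show "solves Velocity_Driven (Linearized_Barus \<beta>) L (\<lambda>_. 1) ?P"
    unfolding solves_def
  proof (intro conjI ballI)
    show "continuous_on {0..1} ?P"
      using \<beta> by (intro continuous_intros resistance_continuous) auto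
  next
    fix x assume "x \<in> {0<..<1} - {interface_pos L}"
    then have d: "(resistance L has_real_derivative - (1 / permeability L x)) (at x)"
      by (intro resistance_derivative) auto
    have "(?P has_real_derivative - (exp (\<beta> * resistance L x) / permeability L x)) (at x)"
      using \<beta> by (auto intro!: derivative_eq_intros d)
    then show "\<exists>p'. (?P has_real_derivative p') (at x) \<and>
        drag (Linearized_Barus \<beta>) (permeability L x) (?P x) 1 * 1 + p' = 0"
      using \<beta> by (intro exI conjI) auto
  qed auto
next
  fix v p x assume sol: "solves Velocity_Driven (Linearized_Barus \<beta>) L v p" and x: "x \<in> {0..1::real}"
  have bc: "v 0 = 1" "p 1 = 0" and p: "continuous_on {0..1} p"
    using sol unfolding solves_def by auto
  have v1: "v y = 1" if "y \<in> {0..1}" for y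
    using solves_velocity_constant[OF sol, of 0] solves_velocity_constant[OF sol that] bc by simp
  then show "v x = 1" using x by blast
  let ?F = "\<lambda>x. (1 + \<beta> * p x) * exp (- (\<beta> * resistance L x))"
  have "?F x = ?F 1"
  proof (rule constant_off_interface[OF _ _ x])
    show "continuous_on {0..1} ?F"
      by (intro continuous_intros resistance_continuous p)
  next
    fix z assume z: "z \<in> {0<..<1} - {interface_pos L}"
    have d: "(resistance L has_real_derivative - (1 / permeability L z)) (at z)"
      using z by (intro resistance_derivative) auto
    have d': "(p has_real_derivative - ((1 + \<beta> * p z) / permeability L z)) (at z)"
      using solves_pressure_derivative[OF sol z] v1[of z] z by simp
    show "(?F has_real_derivative 0) (at z)"
      by (auto intro!: derivative_eq_intros d d')
  qed
  then have "1 + \<beta> * p x = exp (\<beta> * resistance L x)"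
    using bc by (simp add: exp_minus field_simps)
  then show "p x = (exp (\<beta> * resistance L x) - 1) / \<beta>"
    using \<beta> by (simp add: field_simps)
qed

lemmas pressure_driven_Phi =
  pressure_driven_flow(1)[OF unique_flow_pressure_driven_Darcy]
  pressure_driven_flow(1)[OF unique_flow_pressure_driven_Barus]
  pressure_driven_flow(1)[OF unique_flow_pressure_driven_Forchheimer]

lemmas velocity_driven_Phi =
  velocity_driven_flow(1)[OF unique_flow_velocity_driven_Darcy]
  velocity_driven_flow(1)[OF unique_flow_velocity_driven_linearized_Barus]
  velocity_driven_flow(1)[OF unique_flow_velocity_driven_Forchheimer]

lemma design_problem_well_posed:
  assumes "0 < \<beta>B" "0 < \<beta>F" "(d, M) \<in> design_problems \<beta>B \<beta>F"
  shows "well_posed d M L"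
  using assms unfolding design_problems_def
  by (auto intro: unique_flow_well_posed
      unique_flow_pressure_driven_Darcy unique_flow_pressure_driven_Barus
      unique_flow_pressure_driven_Forchheimer unique_flow_velocity_driven_Darcy
      unique_flow_velocity_driven_linearized_Barus unique_flow_velocity_driven_Forchheimer)

end

section \<open>Comparing layouts\<close>

lemma single_interface_two_layer_medium:
  assumes "0 < kL" "kL < kH" "single_interface_layout kH kL L"
  shows "two_layer_medium L"
  using assms unfolding single_interface_layout_def two_layer_medium_def by auto

lemma at_least_as_good_iff_Upsilon_le:
  assumes "two_layer_medium L" "two_layer_medium L'"
    and \<beta>: "0 < \<beta>B" "0 < \<beta>F" and dM: "(d, M) \<in> design_problems \<beta>B \<beta>F"
  shows "at_least_as_good d M L L' \<longleftrightarrow> Upsilon L \<le> Upsilon L'"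
proof -
  interpret L: two_layer_medium L by fact
  interpret L': two_layer_medium L' by fact
  have inv: "inverse (Upsilon L') \<le> inverse (Upsilon L) \<longleftrightarrow> Upsilon L \<le> Upsilon L'"
    using L.Upsilon_pos L'.Upsilon_pos by simp
  consider "d = Pressure_Driven" "M = Darcy"
    | "d = Pressure_Driven" "M = Barus \<beta>B"
    | "d = Pressure_Driven" "M = Darcy_Forchheimer \<beta>F"
    | "d = Velocity_Driven" "M = Darcy"
    | "d = Velocity_Driven" "M = Linearized_Barus \<beta>B"
    | "d = Velocity_Driven" "M = Darcy_Forchheimer \<beta>F"
    using dM unfolding design_problems_def by blast
  then show ?thesis
  proof cases
    case 1
    then show ?thesis
      using inv by (simp add: L.pressure_driven_Phi L'.pressure_driven_Phi inverse_eq_divide)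
  next
    case 2
    have "0 < 1 / \<beta>B * (1 - exp (- \<beta>B))" using \<beta> by simp
    from mult_le_cancel_left_pos[OF this] show ?thesis
      unfolding 2 at_least_as_good.simps L.pressure_driven_Phi(2)[OF \<beta>(1)]
        L'.pressure_driven_Phi(2)[OF \<beta>(1)] using inv by blast
  next
    case 3
    then show ?thesis
      using inv \<beta> by (simp add: L.pressure_driven_Phi L'.pressure_driven_Phi divide_le_cancel)
  next
    case 4
    then show ?thesis
      by (simp add: L.velocity_driven_Phi L'.velocity_driven_Phi L.resistance_inlet L'.resistance_inlet)
  next
    case 5
    then show ?thesis
      using \<beta> by (simp add: L.velocity_driven_Phi L'.velocity_driven_Phi
          L.resistance_inlet L'.resistance_inlet divide_le_cancel)
  next
    case 6
    then show ?thesis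
      using \<beta> by (simp add: L.velocity_driven_Phi L'.velocity_driven_Phi
          L.resistance_inlet L'.resistance_inlet)
  qed
qed

text \<open>\<open>\<Upsilon>\<close> is \<open>1 / kL\<close> diminished in proportion to the length of the highly permeable part, wherever
  that part lies, so minimizing it means using the full allowance \<open>\<gamma>\<close>.\<close>

lemma Upsilon_minimizers_eq:
  assumes k: "0 < kL" "kL < kH" and \<gamma>: "0 \<le> \<gamma>" "\<gamma> \<le> 1"
  shows "Upsilon_minimizers kH kL \<gamma> = {Layout kH kL \<gamma>, Layout kL kH (1 - \<gamma>)}"
    (is "_ = {?in, ?out}")
proof -
  let ?\<delta> = "1 / kL - 1 / kH"
  have \<delta>: "0 < ?\<delta>" using k by (simp add: frac_less2)
  have U: "Upsilon (Layout kH kL \<xi>) = 1 / kL - \<xi> * ?\<delta>"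
    "Upsilon (Layout kL kH \<xi>) = 1 / kL - (1 - \<xi>) * ?\<delta>" for \<xi>
    using k by (simp_all add: Upsilon_def field_simps)
  have optimum: "Upsilon ?in = 1 / kL - \<gamma> * ?\<delta>" "Upsilon ?out = 1 / kL - \<gamma> * ?\<delta>"
    by (simp_all only: U) simp_all
  have adm: "admissible kH kL \<gamma> ?in" "admissible kH kL \<gamma> ?out"
    using \<gamma> k by (auto simp: admissible_def single_interface_layout_def)
  have bound: "1 / kL - \<gamma> * ?\<delta> \<le> Upsilon L \<and>
      (Upsilon L \<le> 1 / kL - \<gamma> * ?\<delta> \<longrightarrow> L \<in> {?in, ?out})"
    if adm_L: "admissible kH kL \<gamma> L" for L
  proof -
    consider \<xi> where "L = Layout kH kL \<xi>" "\<xi> \<le> \<gamma>"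
      | \<xi> where "L = Layout kL kH \<xi>" "1 - \<xi> \<le> \<gamma>"
      using adm_L layout.collapse[of L] unfolding admissible_def single_interface_layout_def by metis
    then show ?thesis
    proof cases
      case 1
      with \<delta> show ?thesis by (simp only: U) (auto simp: mult_le_cancel_right)
    next
      case 2
      with \<delta> show ?thesis by (simp only: U) (auto simp: mult_le_cancel_right)
    qed
  qed
  show ?thesis
  proof (intro equalityI subsetI)
    fix L assume L: "L \<in> Upsilon_minimizers kH kL \<gamma>"
    then have "Upsilon L \<le> Upsilon ?in" using adm unfolding Upsilon_minimizers_def by blast
    with L show "L \<in> {?in, ?out}"
      using bound[of L] unfolding Upsilon_minimizers_def optimum by blast
  next
    fix L assume "L \<in> {?in, ?out}"
    then have "admissible kH kL \<gamma> L" "Upsilon L = 1 / kL - \<gamma> * ?\<delta>" using adm optimum by auto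
    then show "L \<in> Upsilon_minimizers kH kL \<gamma>"
      using bound unfolding Upsilon_minimizers_def by simp
  qed
qed

lemma optimal_layouts_eq_Upsilon_minimizers:
  assumes "0 < kL" "kL < kH" "0 < \<beta>B" "0 < \<beta>F" "(d, M) \<in> design_problems \<beta>B \<beta>F"
  shows "optimal_layouts d M kH kL \<gamma> = Upsilon_minimizers kH kL \<gamma>"
proof -
  have "at_least_as_good d M L L' \<longleftrightarrow> Upsilon L \<le> Upsilon L'"
    if "admissible kH kL \<gamma> L" "admissible kH kL \<gamma> L'" for L L'
    using that assms unfolding admissible_def
    by (intro at_least_as_good_iff_Upsilon_le[of L L' \<beta>B \<beta>F] single_interface_two_layer_medium[of kL kH]) auto
  then show ?thesis
    unfolding optimal_layouts_def Upsilon_minimizers_def by blast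
qed

theorem mainTheorem6:
  fixes kH kL \<gamma> \<beta>B \<beta>F :: real
  assumes "0 < kL" and "kL < kH" and "0 \<le> \<gamma>" and "\<gamma> \<le> 1"
    and "0 < \<beta>B" and "0 < \<beta>F"
  shows
    "(\<forall>L. single_interface_layout kH kL L \<longrightarrow>
        (\<forall>(d, M) \<in> design_problems \<beta>B \<beta>F. well_posed d M L)) \<and>

     (\<forall>L. single_interface_layout kH kL L \<longrightarrow>
        (let \<phi> = 1 / \<beta>B * (1 - exp (- \<beta>B)) * inverse (Upsilon L) in
           (\<forall>v p. solves Pressure_Driven (Barus \<beta>B) L v p \<longrightarrow>
              (\<forall>x\<in>{0..1}. v x = \<phi>) \<and> dissipation_integral (Barus \<beta>B) L v p = \<phi>) \<and>
           Phi Pressure_Driven (Barus \<beta>B) L = \<phi>) \<and>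
        (let \<phi> = (sqrt (1 + 4 * \<beta>F * inverse (Upsilon L)) - 1) / (2 * \<beta>F) in
           (\<forall>v p. solves Pressure_Driven (Darcy_Forchheimer \<beta>F) L v p \<longrightarrow>
              (\<forall>x\<in>{0..1}. v x = \<phi>) \<and> dissipation_integral (Darcy_Forchheimer \<beta>F) L v p = \<phi>) \<and>
           Phi Pressure_Driven (Darcy_Forchheimer \<beta>F) L = \<phi>)) \<and>

     (\<forall>L. single_interface_layout kH kL L \<longrightarrow>
        (let \<phi> = 1 / \<beta>B * (exp (\<beta>B * Upsilon L) - 1) in
           (\<forall>v p. solves Velocity_Driven (Linearized_Barus \<beta>B) L v p \<longrightarrow>
              (\<forall>x\<in>{0..1}. v x = 1) \<and> dissipation_integral (Linearized_Barus \<beta>B) L v p = \<phi>) \<and>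
           Phi Velocity_Driven (Linearized_Barus \<beta>B) L = \<phi>) \<and>
        (let \<phi> = (1 + \<beta>F) * Upsilon L in
           (\<forall>v p. solves Velocity_Driven (Darcy_Forchheimer \<beta>F) L v p \<longrightarrow>
              (\<forall>x\<in>{0..1}. v x = 1) \<and> dissipation_integral (Darcy_Forchheimer \<beta>F) L v p = \<phi>) \<and>
           Phi Velocity_Driven (Darcy_Forchheimer \<beta>F) L = \<phi>)) \<and>

     (\<forall>(d, M) \<in> design_problems \<beta>B \<beta>F.
        (\<forall>L L'. single_interface_layout kH kL L \<longrightarrow> single_interface_layout kH kL L' \<longrightarrow>
           (at_least_as_good d M L L' \<longleftrightarrow> Upsilon L \<le> Upsilon L')) \<and>
        optimal_layouts d M kH kL \<gamma> = Upsilon_minimizers kH kL \<gamma> \<and>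
        optimal_layouts d M kH kL \<gamma> = {Layout kH kL \<gamma>, Layout kL kH (1 - \<gamma>)})"
proof (intro conjI allI impI)
  note medium = single_interface_two_layer_medium[OF assms(1,2)]
  fix L assume L: "single_interface_layout kH kL L"
  interpret two_layer_medium L using L by (rule medium)
  note Barus = pressure_driven_flow[OF unique_flow_pressure_driven_Barus[OF assms(5)]]
  note Forchheimer = pressure_driven_flow[OF unique_flow_pressure_driven_Forchheimer[OF assms(6)]]
  note Barus' = velocity_driven_flow[OF unique_flow_velocity_driven_linearized_Barus[OF assms(5)]]
  note Forchheimer' = velocity_driven_flow[OF unique_flow_velocity_driven_Forchheimer]
  show "\<forall>(d, M) \<in> design_problems \<beta>B \<beta>F. well_posed d M L"
    using design_problem_well_posed[OF assms(5,6)] by blast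
  show "let \<phi> = 1 / \<beta>B * (1 - exp (- \<beta>B)) * inverse (Upsilon L) in
      (\<forall>v p. solves Pressure_Driven (Barus \<beta>B) L v p \<longrightarrow>
        (\<forall>x\<in>{0..1}. v x = \<phi>) \<and> dissipation_integral (Barus \<beta>B) L v p = \<phi>) \<and>
      Phi Pressure_Driven (Barus \<beta>B) L = \<phi>"
    using Barus unfolding Let_def by blast
  show "let \<phi> = (sqrt (1 + 4 * \<beta>F * inverse (Upsilon L)) - 1) / (2 * \<beta>F) in
      (\<forall>v p. solves Pressure_Driven (Darcy_Forchheimer \<beta>F) L v p \<longrightarrow>
        (\<forall>x\<in>{0..1}. v x = \<phi>) \<and> dissipation_integral (Darcy_Forchheimer \<beta>F) L v p = \<phi>) \<and>
      Phi Pressure_Driven (Darcy_Forchheimer \<beta>F) L = \<phi>"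
    using Forchheimer unfolding Let_def by blast
  show "let \<phi> = 1 / \<beta>B * (exp (\<beta>B * Upsilon L) - 1) in
      (\<forall>v p. solves Velocity_Driven (Linearized_Barus \<beta>B) L v p \<longrightarrow>
        (\<forall>x\<in>{0..1}. v x = 1) \<and> dissipation_integral (Linearized_Barus \<beta>B) L v p = \<phi>) \<and>
      Phi Velocity_Driven (Linearized_Barus \<beta>B) L = \<phi>"
    using Barus' by (simp add: Let_def resistance_inlet)
  show "let \<phi> = (1 + \<beta>F) * Upsilon L in
      (\<forall>v p. solves Velocity_Driven (Darcy_Forchheimer \<beta>F) L v p \<longrightarrow>
        (\<forall>x\<in>{0..1}. v x = 1) \<and> dissipation_integral (Darcy_Forchheimer \<beta>F) L v p = \<phi>) \<and>
      Phi Velocity_Driven (Darcy_Forchheimer \<beta>F) L = \<phi>"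
    using Forchheimer' by (simp add: Let_def resistance_inlet)
next
  show "\<forall>(d, M) \<in> design_problems \<beta>B \<beta>F.
      (\<forall>L L'. single_interface_layout kH kL L \<longrightarrow> single_interface_layout kH kL L' \<longrightarrow>
        (at_least_as_good d M L L' \<longleftrightarrow> Upsilon L \<le> Upsilon L')) \<and>
      optimal_layouts d M kH kL \<gamma> = Upsilon_minimizers kH kL \<gamma> \<and>
      optimal_layouts d M kH kL \<gamma> = {Layout kH kL \<gamma>, Layout kL kH (1 - \<gamma>)}"
    using at_least_as_good_iff_Upsilon_le[of _ _ \<beta>B \<beta>F]
      optimal_layouts_eq_Upsilon_minimizers[of kL kH \<beta>B \<beta>F]
      single_interface_two_layer_medium[of kL kH] Upsilon_minimizers_eq[of kL kH \<gamma>] assms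
    by auto
qed

end
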